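(* a) The monoid $\mathcal{M}$ is free in the alphabet $\mathcal{A}$. b) For $\mathbf{a}\in\widetilde{\mathcal{C}}$, the map $\mathrm{ev}_{\mathbf{a}}:\mathcal{M}_{\mathbf{a}}\to\widetilde{\mathcal{C}}$, $w\mapsto w(\mathbf{a})$, is injective. c) Let $\mathbf{a},\mathbf{b}\in\widetilde{\mathcal{C}}$ be such that $\mathbf{b}\notin\mathrm{im}(\mathrm{ev}_{\mathbf{a}})$. Then $\mathrm{im}(\mathrm{ev}_{\mathbf{a}})\cap\mathrm{im}(\mathrm{ev}_{\mathbf{b}})=\emptyset$.
   Context: $\mathbb{N}=\{0,1,2,\dots\}$, $\mathbb{N}^*=\mathbb{N}\setminus\{0\}$. For $n\in\mathbb{N}^*$, $\mathcal{C}_n$ is the set of compositions of $n$, i.e. finite sequences $(a_1,\dots,a_r)$ ($r\ge1$) of positive integers with sum $n$; $p(\cdot)$ denotes the number of parts. Put $\widetilde{\mathcal{C}}=\bigcup_{n\in\mathbb{N}^*}\mathcal{C}_n\times\mathcal{C}_n$. An element is written $\mathbf{a}=(\mathbf{a}^+,\mathbf{a}^-)$ with $\mathbf{a}^\pm=(a_1^\pm,\dots,a^\pm_{p(\mathbf{a}^\pm)})$. Add a null element $\mathbf{o}$: $\overline{\mathcal{C}}=\widetilde{\mathcal{C}}\cup\{\mathbf{o}\}$. Operators on $\overline{\mathcal{C}}$, for $m\in\mathbb{N}$; each fixes $\mathbf{o}$, and for $\mathbf{a}\in\widetilde{\mathcal{C}}$: - $\rho(\mathbf{a})=(\mathbf{a}^-,\mathbf{a}^+)$;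 - $\sigma_m^+(\mathbf{a})=\bigl(((m+2)a_1^+,a_2^+,\dots,a^+_{p(\mathbf{a}^+)}),\ ((m+1)a_1^+,a_1^-,\dots,a^-_{p(\mathbf{a}^-)})\bigr)$; - $\tau_m^+(\mathbf{a})=\bigl(((m+1)a_1^++(m+2)a_2^+,a_3^+,\dots,a^+_{p(\mathbf{a}^+)}),\ (ma_1^++(m+1)a_2^+,a_1^-,\dots,a^-_{p(\mathbf{a}^-)})\bigr)$ if $p(\mathbf{a}^+)>1$, and $\tau_m^+(\mathbf{a})=\mathbf{o}$ if $p(\mathbf{a}^+)=1$; - $\sigma_m^-=\rho\sigma_m^+\rho$, $\tau_m^-=\rho\tau_m^+\rho$. Let $\mathcal{A}=\{\sigma_m^{\pm},\tau_m^{\pm} : m\in\mathbb{N}\}$ and let $\mathcal{M}$ be the submonoid generated by $\mathcal{A}$ in the monoid (under composition) of maps $\overline{\mathcal{C}}\to\overline{\mathcal{C}}$; it contains the identity map. For $\mathbf{a}\in\widetilde{\mathcal{C}}$, $\mathcal{M}_{\mathbf{a}}=\{w\in\mathcal{M} : w(\mathbf{a})\neq\mathbf{o}\}$, and $\mathrm{im}(\mathrm{ev}_{\mathbf{a}})=\{w(\mathbf{a}) : w\in\mathcal{M}_{\mathbf{a}}\}$ is the image of the map $\mathrm{ev}_{\mathbf{a}}$ of part b). "Free in the alphabet $\mathcal{A}$" means that every element of $\mathcal{M}$ is uniquely a finite (possibly empty) product of elements of $\mathcal{A}$.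
   Formalization: In c) the extra hypothesis a ∉ im(ev_b) is added, since c) is false without it: for b=((1),(1)) and a=σ_0^+(b)=((2),(1,1)), b ∉ im(ev_a), yet a lies in both images; whenever a ∈ im(ev_b), the conclusion fails. *)

theory Defs
  imports Main
begin

definition compositions :: "nat \<Rightarrow> nat list set" where
  "compositions n = {xs. xs \<noteq> [] \<and> (\<forall>x\<in>set xs. 0 < x) \<and> sum_list xs = n}"

text \<open>
  A type, rather than a subset of pairs of lists, is used for the pairs of compositions of a common
  positive integer, so that \<open>bicomp option\<close> is exactly this set with a null element
  \<open>None\<close> adjoined, and equality of functions on \<open>bicomp option\<close> is equality of the maps in question.
\<close>

typedef bicomp = "\<Union>n\<in>{1::nat..}. compositions n \<times> compositions n"
proof
  show "([1], [1]) \<in> (\<Union>n\<in>{1::nat..}. compositions n \<times> compositions n)"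
    by (auto simp: compositions_def)
qed

setup_lifting type_definition_bicomp

type_synonym bicomp_map = "bicomp option \<Rightarrow> bicomp option"

lift_definition swap_bicomp :: "bicomp \<Rightarrow> bicomp" is "\<lambda>(p, q). (q, p)"
  by auto

lift_definition sigma_bicomp :: "nat \<Rightarrow> bicomp \<Rightarrow> bicomp" is
  "\<lambda>m (p, q). ((m + 2) * hd p # tl p, (m + 1) * hd p # q)"
  subgoal for m pq
    by (cases pq; cases "fst pq") (auto simp: compositions_def)
  done

lift_definition tau_bicomp :: "nat \<Rightarrow> bicomp \<Rightarrow> bicomp option" is
  "\<lambda>m (p, q). case p of
      x # y # r \<Rightarrow> Some (((m + 1) * x + (m + 2) * y) # r, (m * x + (m + 1) * y) # q)
    | _ \<Rightarrow> None"
  subgoal for m pq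
    by (cases pq) (auto simp: compositions_def split: list.splits)
  done

definition rho :: bicomp_map where
  "rho = map_option swap_bicomp"

definition sigma_plus :: "nat \<Rightarrow> bicomp_map" where
  "sigma_plus m = map_option (sigma_bicomp m)"

definition tau_plus :: "nat \<Rightarrow> bicomp_map" where
  "tau_plus m x = Option.bind x (tau_bicomp m)"

definition sigma_minus :: "nat \<Rightarrow> bicomp_map" where
  "sigma_minus m = rho \<circ> sigma_plus m \<circ> rho"

definition tau_minus :: "nat \<Rightarrow> bicomp_map" where
  "tau_minus m = rho \<circ> tau_plus m \<circ> rho"

definition alphabet :: "bicomp_map set" where
  "alphabet = range sigma_plus \<union> range sigma_minus \<union> range tau_plus \<union> range tau_minus"

inductive_set generated_submonoid :: "('a \<Rightarrow> 'a) set \<Rightarrow> ('a \<Rightarrow> 'a) set"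
  for A :: "('a \<Rightarrow> 'a) set" where
  id: "id \<in> generated_submonoid A"
| gen: "f \<in> A \<Longrightarrow> f \<in> generated_submonoid A"
| comp: "f \<in> generated_submonoid A \<Longrightarrow> g \<in> generated_submonoid A
    \<Longrightarrow> f \<circ> g \<in> generated_submonoid A"

definition word_product :: "('a \<Rightarrow> 'a) list \<Rightarrow> 'a \<Rightarrow> 'a" where
  "word_product ws = foldr (\<circ>) ws id"

definition free_in_alphabet :: "('a \<Rightarrow> 'a) set \<Rightarrow> ('a \<Rightarrow> 'a) set \<Rightarrow> bool" where
  "free_in_alphabet N A \<longleftrightarrow> (\<forall>w\<in>N. \<exists>!ws. ws \<in> lists A \<and> word_product ws = w)"

definition Mon :: "bicomp_map set" where
  "Mon = generated_submonoid alphabet"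

definition Mon_at :: "bicomp \<Rightarrow> bicomp_map set" where
  "Mon_at a = {w \<in> Mon. w (Some a) \<noteq> None}"

text \<open>Only meaningful on \<open>Mon_at a\<close>, where the value of \<open>w\<close> at \<open>a\<close> is not null.\<close>

definition ev :: "bicomp \<Rightarrow> bicomp_map \<Rightarrow> bicomp" where
  "ev a w = the (w (Some a))"

definition im_ev :: "bicomp \<Rightarrow> bicomp set" where
  "im_ev a = ev a ` Mon_at a"

text \<open>
  The condition \<open>b \<notin> im_ev a\<close> alone does not make \<open>im_ev a\<close> and \<open>im_ev b\<close> disjoint: every
  letter strictly increases the common sum of the two compositions, so it holds whenever
  \<open>a = w(b)\<close> for some \<open>w \<in> Mon\<close>, \<open>w \<noteq> id\<close>, while \<open>a\<close> then belongs to both images. For disjointness,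
  \<open>a \<notin> im_ev b\<close> is needed as well.
\<close>

lift_definition weight :: "bicomp \<Rightarrow> nat" is "\<lambda>(p, q). sum_list p" .

lemma weight_swap: "weight (swap_bicomp a) = weight a"
  by transfer (auto simp: compositions_def)

lemma weight_sigma: "weight a < weight (sigma_bicomp m a)"
  by transfer (auto simp: compositions_def neq_Nil_conv)

lemma weight_tau: "tau_bicomp m a = Some b \<Longrightarrow> weight a < weight b"
  by transfer (auto simp: compositions_def split: list.splits)

lemma weight_rho: "rho x = Some b \<Longrightarrow> \<exists>a. x = Some a \<and> weight a = weight b"
  by (cases x) (auto simp: rho_def weight_swap)

lemma weight_sigma_plus: "sigma_plus m x = Some b \<Longrightarrow> \<exists>a. x = Some a \<and> weight a < weight b"
  by (cases x) (auto simp: sigma_plus_def weight_sigma)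

lemma weight_tau_plus: "tau_plus m x = Some b \<Longrightarrow> \<exists>a. x = Some a \<and> weight a < weight b"
  by (cases x) (auto simp: tau_plus_def dest: weight_tau)

lemma weight_letter:
  assumes "f \<in> alphabet" "f x = Some b"
  shows "\<exists>a. x = Some a \<and> weight a < weight b"
proof -
  have conj: "\<exists>a. x = Some a \<and> weight a < weight b"
    if "rho (g (rho x)) = Some b"
      and "\<And>y c. g y = Some c \<Longrightarrow> \<exists>a. y = Some a \<and> weight a < weight c" for g
    using that weight_rho by metis
  consider m where "f = sigma_plus m" | m where "f = tau_plus m"
    | m where "f = sigma_minus m" | m where "f = tau_minus m"
    using assms(1) by (auto simp: alphabet_def)
  then show ?thesis
  proof cases
    case 1 then show ?thesis using assms(2) weight_sigma_plus by simp
  next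
    case 2 then show ?thesis using assms(2) weight_tau_plus by simp
  next
    case 3 then show ?thesis
      using assms(2) conj[of "sigma_plus _"] weight_sigma_plus by (simp add: sigma_minus_def)
  next
    case 4 then show ?thesis
      using assms(2) conj[of "tau_plus _"] weight_tau_plus by (simp add: tau_minus_def)
  qed
qed

lemma weight_Mon:
  assumes "w \<in> Mon" "w x = Some b"
  shows "\<exists>a. x = Some a \<and> weight a \<le> weight b"
  using assms unfolding Mon_def
proof (induction arbitrary: x b)
  case (gen f)
  then show ?case using weight_letter by (meson less_imp_le)
next
  case (comp f g)
  then show ?case by (metis comp_apply order_trans)
qed simp

lemma im_ev_not_disjoint: "\<exists>a b. b \<notin> im_ev a \<and> im_ev a \<inter> im_ev b \<noteq> {}"
proof (intro exI conjI)
  fix b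
  let ?a = "sigma_bicomp 0 b"
  have "id \<in> Mon" "sigma_plus 0 \<in> Mon"
    by (auto simp: Mon_def alphabet_def intro: generated_submonoid.intros)
  then have "id \<in> Mon_at ?a" "sigma_plus 0 \<in> Mon_at b"
    by (auto simp: Mon_at_def sigma_plus_def)
  moreover have "?a = ev ?a id" "?a = ev b (sigma_plus 0)"
    by (auto simp: ev_def sigma_plus_def)
  ultimately have "?a \<in> im_ev ?a" "?a \<in> im_ev b"
    unfolding im_ev_def by blast+
  then show "im_ev ?a \<inter> im_ev b \<noteq> {}" by blast
  show "b \<notin> im_ev ?a"
  proof
    assume "b \<in> im_ev ?a"
    then obtain w where "w \<in> Mon" "w (Some ?a) = Some b"
      by (auto simp: im_ev_def Mon_at_def ev_def)
    then have "weight ?a \<le> weight b" using weight_Mon by fastforce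
    then show False using weight_sigma[of b 0] by simp
  qed
qed

end

theory Submission
  imports Defs
begin

text \<open>
  The whole proposition rests on one fact: an element of \<open>bicomp\<close> is the value of at most one letter
  at at most one argument (\<open>last_letter_unique\<close>). Indeed, let the leading parts of the element be
  \<open>p\<close> and \<open>q\<close>. A plus letter produces \<open>q < p\<close> and a minus letter \<open>p < q\<close>, so the sign is visible.
  For a plus letter, divide \<open>q\<close> by \<open>p - q\<close>. For \<open>\<sigma>\<^sub>m\<close> the difference is the old leading part
  \<open>a\<close> and \<open>q = (m + 1) a\<close>: the remainder is zero and the quotient is \<open>m + 1\<close>. For \<open>\<tau>\<^sub>m\<close>, with
  \<open>x\<close> and \<open>y\<close> the two old leading parts, the difference is \<open>x + y\<close> and \<open>q = m (x + y) + y\<close>: the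
  remainder \<open>y\<close> is positive and the quotient is \<open>m\<close>. So Euclidean division recovers the letter and
  the argument. The minus case is conjugate to this one by \<open>rho\<close>.

  Consequently, if two words send \<open>a\<close> and \<open>b\<close> to the same element, letters can be cancelled from
  the left of both words until one of them is used up; then \<open>b\<close> is reached from \<open>a\<close> or \<open>a\<close> from
  \<open>b\<close> (\<open>words_meet\<close>). Disjointness of the images is the contrapositive. If \<open>a = b\<close>, what is left over is a word
  fixing \<open>a\<close>, hence the empty word, since letters increase the weight; so a word is determined by
  its value at any single element where it is not null (\<open>word_determined_by_value\<close>). This is
  injectivity of evaluation, and it also gives freeness, because each word is defined at every
  pair of sufficiently long compositions (\<open>ex_word_defined\<close>).
\<close>

section \<open>Recovering the last letter applied\<close>

lemma sigma_bicomp_inject: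
  assumes "sigma_bicomp m a = sigma_bicomp n b"
  shows "m = n \<and> a = b"
  using assms
proof transfer
  fix m n :: nat and a b :: "nat list \<times> nat list"
  assume *: "a \<in> (\<Union>n\<in>{1..}. compositions n \<times> compositions n)"
    "b \<in> (\<Union>n\<in>{1..}. compositions n \<times> compositions n)"
    "(case a of (p, q) \<Rightarrow> ((m + 2) * hd p # tl p, (m + 1) * hd p # q)) =
     (case b of (p, q) \<Rightarrow> ((n + 2) * hd p # tl p, (n + 1) * hd p # q))"
  then obtain x p q y r s where ab: "a = (x # p, q)" "b = (y # r, s)" "0 < x"
    by (auto simp: compositions_def neq_Nil_conv)
  with * have "x + (m + 1) * x = y + (n + 1) * y" "(m + 1) * x = (n + 1) * y" "p = r" "q = s"
    by auto
  moreover from this have "x = y" by linarith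
  ultimately show "m = n \<and> a = b" using ab by simp
qed

text \<open>
  Here \<open>x + y\<close> is the difference of the two leading parts that \<open>\<tau>\<^sub>m\<close> produces (see
  \<open>tau_leading_parts\<close>), so \<open>m\<close> and \<open>y\<close> can be computed from these parts alone.
\<close>

lemma div_mod_of_tau:
  fixes m x y :: nat
  assumes "0 < x" "0 < y"
  shows "(m * x + (m + 1) * y) div (x + y) = m" "(m * x + (m + 1) * y) mod (x + y) = y"
proof -
  have eq: "m * x + (m + 1) * y = m * (x + y) + y" by (simp add: algebra_simps)
  have "y < x + y" using assms by simp
  then show "(m * x + (m + 1) * y) div (x + y) = m" "(m * x + (m + 1) * y) mod (x + y) = y"
    unfolding eq by simp_all
qed

lemma tau_leading_parts:
  fixes m x y :: nat
  shows "(m + 1) * x + (m + 2) * y = (x + y) + (m * x + (m + 1) * y)"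
  by (simp add: algebra_simps)

lemma tau_bicomp_inject:
  assumes "tau_bicomp m a = Some c" "tau_bicomp n b = Some c"
  shows "m = n \<and> a = b"
  using assms
proof transfer
  fix m n :: nat and a b c :: "nat list \<times> nat list"
  assume *: "a \<in> (\<Union>n\<in>{1..}. compositions n \<times> compositions n)"
    "b \<in> (\<Union>n\<in>{1..}. compositions n \<times> compositions n)"
    "(case a of (p, q) \<Rightarrow> case p of x # y # r \<Rightarrow>
        Some (((m + 1) * x + (m + 2) * y) # r, (m * x + (m + 1) * y) # q) | _ \<Rightarrow> None) = Some c"
    "(case b of (p, q) \<Rightarrow> case p of x # y # r \<Rightarrow>
        Some (((n + 1) * x + (n + 2) * y) # r, (n * x + (n + 1) * y) # q) | _ \<Rightarrow> None) = Some c"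
  from *(1,3) obtain x y p q where a: "a = (x # y # p, q)" "0 < x" "0 < y"
    "c = (((m + 1) * x + (m + 2) * y) # p, (m * x + (m + 1) * y) # q)"
    by (auto simp: compositions_def split: list.splits prod.splits)
  from *(2,4) obtain u v r s where b: "b = (u # v # r, s)" "0 < u" "0 < v"
    "c = (((n + 1) * u + (n + 2) * v) # r, (n * u + (n + 1) * v) # s)"
    by (auto simp: compositions_def split: list.splits prod.splits)
  have eq: "m * x + (m + 1) * y = n * u + (n + 1) * v" "p = r" "q = s"
    and "(m + 1) * x + (m + 2) * y = (n + 1) * u + (n + 2) * v"
    using a(4) b(4) by auto
  then have sum: "x + y = u + v" unfolding tau_leading_parts by linarith
  have "m = n" "y = v"
    using div_mod_of_tau[OF a(2,3), of m] div_mod_of_tau[OF b(2,3), of n] eq(1) sum by simp_all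
  then show "m = n \<and> a = b" using a b eq sum by simp
qed

lemma tau_bicomp_neq_sigma_bicomp: "tau_bicomp n b \<noteq> Some (sigma_bicomp m a)"
proof transfer
  fix m n :: nat and a b :: "nat list \<times> nat list"
  assume *: "a \<in> (\<Union>n\<in>{1..}. compositions n \<times> compositions n)"
    "b \<in> (\<Union>n\<in>{1..}. compositions n \<times> compositions n)"
  show "(case b of (p, q) \<Rightarrow> case p of x # y # r \<Rightarrow>
        Some (((n + 1) * x + (n + 2) * y) # r, (n * x + (n + 1) * y) # q) | _ \<Rightarrow> None) \<noteq>
     Some (case a of (p, q) \<Rightarrow> ((m + 2) * hd p # tl p, (m + 1) * hd p # q))"
    (is "?t \<noteq> Some ?s")
  proof
    assume eq: "?t = Some ?s"
    from *(2) eq obtain u v r s where b: "b = (u # v # r, s)" "0 < u" "0 < v"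
      by (auto simp: compositions_def split: list.splits prod.splits)
    obtain p q where a: "a = (p, q)" by fastforce
    define x where "x = hd p"
    have "(n + 1) * u + (n + 2) * v = x + (m + 1) * x" "n * u + (n + 1) * v = (m + 1) * x"
      using eq a b by (auto simp: x_def)
    then have "u + v = x" unfolding tau_leading_parts by linarith
    \<comment> \<open>the remainder is \<open>v\<close> by the shape of \<open>\<tau>\<close>, and zero by that of \<open>\<sigma>\<close>\<close>
    then have "v = ((m + 1) * x) mod x"
      using div_mod_of_tau(2)[OF b(2,3), of n] \<open>n * u + (n + 1) * v = (m + 1) * x\<close> by simp
    then show False using b(3) by simp
  qed
qed

lift_definition plus_leads :: "bicomp \<Rightarrow> bool" is "\<lambda>(p, q). hd q < hd p" .

lemma plus_leads_sigma: "plus_leads (sigma_bicomp m a)"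
  by transfer (auto simp: compositions_def neq_Nil_conv)

lemma plus_leads_tau: "tau_bicomp m a = Some b \<Longrightarrow> plus_leads b"
  by transfer (auto simp: compositions_def split: list.splits)

lemma plus_leads_swap: "plus_leads a \<Longrightarrow> \<not> plus_leads (swap_bicomp a)"
  by transfer auto

lemma rho_rho [simp]: "rho (rho x) = x"
proof -
  have "swap_bicomp (swap_bicomp a) = a" for a by transfer auto
  then show ?thesis by (cases x) (simp_all add: rho_def)
qed

definition plus_letters :: "bicomp_map set" where
  "plus_letters = range sigma_plus \<union> range tau_plus"

lemma plus_letter_unique:
  assumes "f \<in> plus_letters" "g \<in> plus_letters" "f x = Some c" "g y = Some c"
  shows "f = g \<and> x = y"
proof -
  obtain a b where xy: "x = Some a" "y = Some b"
    using assms by (cases x; cases y) (auto simp: plus_letters_def sigma_plus_def tau_plus_def)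
  show ?thesis
    using assms unfolding plus_letters_def xy
    by (auto simp: sigma_plus_def tau_plus_def tau_bicomp_neq_sigma_bicomp
        dest: sigma_bicomp_inject tau_bicomp_inject)
qed

lemma plus_leads_plus_letter: "f \<in> plus_letters \<Longrightarrow> f x = Some c \<Longrightarrow> plus_leads c"
  by (cases x) (auto simp: plus_letters_def sigma_plus_def tau_plus_def
      plus_leads_sigma plus_leads_tau)

lemma alphabet_cases [consumes 1, case_names plus minus]:
  assumes "f \<in> alphabet"
  obtains "f \<in> plus_letters" | g where "g \<in> plus_letters" "f = rho \<circ> g \<circ> rho"
  using assms unfolding alphabet_def plus_letters_def sigma_minus_def tau_minus_def by blast

lemma not_plus_leads_minus_letter:
  assumes "g \<in> plus_letters" "rho (g x) = Some c"
  shows "\<not> plus_leads c"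
  using assms plus_leads_plus_letter[of g x] plus_leads_swap by (auto simp: rho_def)

text \<open>
  The leading parts show the sign of the letter; minus letters are then conjugated to plus letters.
\<close>

lemma last_letter_unique:
  assumes "f \<in> alphabet" "g \<in> alphabet" "f x = Some c" "g y = Some c"
  shows "f = g \<and> x = y"
  using assms(1)
proof (cases rule: alphabet_cases)
  case plus
  show ?thesis using assms(2)
  proof (cases rule: alphabet_cases)
    case plus
    then show ?thesis using plus_letter_unique[of f g x c y] \<open>f \<in> plus_letters\<close> assms(3,4) by simp
  next
    case (minus g')
    then show ?thesis
      using plus_leads_plus_letter[OF plus assms(3)] not_plus_leads_minus_letter[of g' "rho y" c]
        assms(4) by simp
  qed
next
  case f: (minus f')
  show ?thesis using assms(2)
  proof (cases rule: alphabet_cases)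
    case plus
    then show ?thesis
      using plus_leads_plus_letter[OF plus assms(4)] not_plus_leads_minus_letter[of f' "rho x" c]
        assms(3) f by simp
  next
    case g: (minus g')
    have "f' (rho x) = rho (f x)" "g' (rho y) = rho (g y)"
      unfolding f(2) g(2) by simp_all
    then have "f' (rho x) = Some (swap_bicomp c)" "g' (rho y) = Some (swap_bicomp c)"
      unfolding assms(3,4) by (simp_all add: rho_def)
    then have eq: "f' = g' \<and> rho x = rho y"
      by (rule plus_letter_unique[OF f(1) g(1)])
    then have "rho (rho x) = rho (rho y)" by (blast intro: arg_cong)
    then have "x = y" by simp
    then show ?thesis using eq f(2) g(2) by simp
  qed
qed

section \<open>Words\<close>

lemma word_product_Nil [simp]: "word_product [] = id"
  by (simp add: word_product_def)

lemma word_product_Cons [simp]: "word_product (f # ws) = f \<circ> word_product ws"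
  by (simp add: word_product_def)

lemma word_product_append: "word_product (us @ vs) = word_product us \<circ> word_product vs"
  by (induction us) (simp_all add: comp_assoc)

lemma generated_submonoid_eq_words: "generated_submonoid A = word_product ` lists A"
proof (intro equalityI subsetI)
  fix w assume "w \<in> generated_submonoid A"
  then show "w \<in> word_product ` lists A"
  proof induction
    case id
    show ?case by (rule image_eqI[of _ _ "[]"]) simp_all
  next
    case (gen f)
    then show ?case by (intro image_eqI[of _ _ "[f]"]) simp_all
  next
    case (comp f g)
    then obtain us vs where "f = word_product us" "g = word_product vs" "us @ vs \<in> lists A"
      by auto
    then show ?case by (metis imageI word_product_append)
  qed
next
  fix w assume "w \<in> word_product ` lists A"
  then obtain ws where "ws \<in> lists A" "w = word_product ws" by blast
  then show "w \<in> generated_submonoid A"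
    by (induction ws arbitrary: w) (auto intro: generated_submonoid.intros)
qed

lemma Mon_eq_words: "Mon = word_product ` lists alphabet"
  by (simp add: Mon_def generated_submonoid_eq_words)

text \<open>A nonempty word strictly increases the weight.\<close>

lemma word_fixes_imp_Nil:
  assumes "ws \<in> lists alphabet" "word_product ws (Some a) = Some a"
  shows "ws = []"
proof (cases ws)
  case (Cons f vs)
  then obtain b where b: "word_product vs (Some a) = Some b" "weight b < weight a"
    using assms weight_letter[of f "word_product vs (Some a)" a] by auto
  have "word_product vs \<in> Mon" using Cons assms by (auto simp: Mon_eq_words)
  then have "weight a \<le> weight b" using weight_Mon b(1) by fastforce
  with b(2) show ?thesis by simp
qed

text \<open>
  Cancelling equal letters from the left keeps the two values equal, by
  \<open>last_letter_unique\<close>, so one word is an initial segment of the other.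
\<close>

lemma words_meet:
  assumes "ws \<in> lists alphabet" "vs \<in> lists alphabet"
    and "word_product ws (Some a) = Some c" "word_product vs (Some b) = Some c"
  shows "\<exists>us\<in>lists alphabet. ws = vs @ us \<and> word_product us (Some a) = Some b
    \<or> vs = ws @ us \<and> word_product us (Some b) = Some a"
  using assms
proof (induction ws arbitrary: vs c)
  case Nil
  then show ?case by auto
next
  case (Cons f ws)
  show ?case
  proof (cases vs)
    case Nil
    then show ?thesis using Cons.hyps Cons.prems by (intro bexI[of _ "f # ws"]) simp_all
  next
    case (Cons g vs')
    then have fg: "f = g" and eq: "word_product ws (Some a) = word_product vs' (Some b)"
      using last_letter_unique[of f g "word_product ws (Some a)" c "word_product vs' (Some b)"]
        Cons.hyps Cons.prems by auto
    obtain d where "word_product ws (Some a) = Some d"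
      using weight_letter[of f "word_product ws (Some a)" c] Cons.hyps Cons.prems by auto
    then show ?thesis
      using Cons.IH[of vs' d] Cons.prems eq fg Cons by auto
  qed
qed

lemma word_determined_by_value:
  assumes "ws \<in> lists alphabet" "vs \<in> lists alphabet"
    and "word_product ws (Some a) = Some c" "word_product vs (Some a) = Some c"
  shows "ws = vs"
proof -
  obtain us where "us \<in> lists alphabet" "ws = vs @ us \<or> vs = ws @ us"
    "word_product us (Some a) = Some a"
    using words_meet[OF assms] by blast
  then show ?thesis using word_fixes_imp_Nil by auto
qed

section \<open>Elements on which a given word is not null\<close>

text \<open>
  A letter gives \<open>None\<close> only where it needs a missing second part, and it shortens either composition
  by at most one part. Hence every word shorter than the smaller number of parts is defined.
\<close>

lift_definition width :: "bicomp \<Rightarrow> nat" is "\<lambda>(p, q). min (length p) (length q)" .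

lemma width_swap [simp]: "width (swap_bicomp a) = width a"
  by transfer auto

lemma width_sigma: "width a \<le> width (sigma_bicomp m a)"
  by transfer (auto simp: compositions_def neq_Nil_conv)

lemma tau_defined: "1 < width a \<Longrightarrow> tau_bicomp m a \<noteq> None"
  by transfer (auto split: list.splits prod.splits)

lemma width_tau: "tau_bicomp m a = Some b \<Longrightarrow> width a \<le> Suc (width b)"
  by transfer (auto split: list.splits)

lemma plus_letter_width:
  assumes "f \<in> plus_letters" "1 < width a"
  shows "\<exists>b. f (Some a) = Some b \<and> width a \<le> Suc (width b)"
proof -
  consider m where "f = sigma_plus m" | m where "f = tau_plus m"
    using assms(1) by (auto simp: plus_letters_def)
  then show ?thesis
  proof cases
    case (1 m)
    then show ?thesis using width_sigma[of a m] by (simp add: sigma_plus_def)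
  next
    case (2 m)
    obtain b where "tau_bicomp m a = Some b" using tau_defined[OF assms(2)] by blast
    then show ?thesis using 2 width_tau by (simp add: tau_plus_def)
  qed
qed

lemma letter_width:
  assumes "f \<in> alphabet" "1 < width a"
  shows "\<exists>b. f (Some a) = Some b \<and> width a \<le> Suc (width b)"
  using assms(1)
proof (cases rule: alphabet_cases)
  case plus
  then show ?thesis using plus_letter_width assms by blast
next
  case (minus g)
  then show ?thesis using plus_letter_width[of g "swap_bicomp a"] assms by (auto simp: rho_def)
qed

lemma word_width:
  assumes "ws \<in> lists alphabet" "length ws < width a"
  shows "\<exists>b. word_product ws (Some a) = Some b \<and> width a \<le> length ws + width b"
  using assms
proof (induction ws)
  case (Cons f ws)
  then obtain b where b: "word_product ws (Some a) = Some b" "width a \<le> length ws + width b"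
    by auto
  have "f \<in> alphabet" "1 < width b" using Cons.hyps Cons.prems b(2) by simp_all
  then obtain c where "f (Some b) = Some c" "width b \<le> Suc (width c)"
    using letter_width by blast
  with b show ?case by simp
qed simp

lemma ex_width: "\<exists>a. width a = Suc k"
proof -
  let ?p = "replicate (Suc k) (1::nat)"
  have "?p \<in> compositions (Suc k)"
    by (auto simp: compositions_def sum_list_replicate simp del: replicate.simps)
  then have "(?p, ?p) \<in> (\<Union>n\<in>{1..}. compositions n \<times> compositions n)"
    by (intro UN_I[of "Suc k"]) auto
  then have "width (Abs_bicomp (?p, ?p)) = Suc k"
    by (simp add: width.rep_eq Abs_bicomp_inverse del: replicate.simps)
  then show ?thesis ..
qed

lemma ex_word_defined:
  assumes "ws \<in> lists alphabet"
  shows "\<exists>a c. word_product ws (Some a) = Some c"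
proof -
  obtain a where "width a = Suc (length ws)" using ex_width by blast
  then show ?thesis using word_width[OF assms, of a] by auto
qed

section \<open>Freeness, injectivity and disjointness\<close>

theorem proposition2p4:
  shows "free_in_alphabet Mon alphabet
    \<and> (\<forall>a. inj_on (ev a) (Mon_at a))
    \<and> (\<forall>a b. b \<notin> im_ev a \<longrightarrow> a \<notin> im_ev b \<longrightarrow> im_ev a \<inter> im_ev b = {})"
proof (intro conjI allI impI)
  show "free_in_alphabet Mon alphabet"
    unfolding free_in_alphabet_def
  proof
    fix w assume "w \<in> Mon"
    then obtain ws where ws: "ws \<in> lists alphabet" "word_product ws = w"
      by (auto simp: Mon_eq_words)
    then obtain a c where "w (Some a) = Some c" using ex_word_defined by blast
    then have "vs = ws" if "vs \<in> lists alphabet" "word_product vs = w" for vs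
      using word_determined_by_value[OF that(1) ws(1)] that(2) ws(2) by simp
    with ws show "\<exists>!ws. ws \<in> lists alphabet \<and> word_product ws = w" by blast
  qed
next
  fix a
  show "inj_on (ev a) (Mon_at a)"
  proof (rule inj_onI)
    fix v w assume "v \<in> Mon_at a" "w \<in> Mon_at a" and eq: "ev a v = ev a w"
    then obtain vs ws c where "vs \<in> lists alphabet" "ws \<in> lists alphabet"
      and "v = word_product vs" "w = word_product ws"
      and "v (Some a) = Some c" "w (Some a) = Some c"
      unfolding Mon_at_def Mon_eq_words ev_def by fastforce
    then show "v = w" using word_determined_by_value by metis
  qed
next
  have im_ev_iff: "c \<in> im_ev a \<longleftrightarrow> (\<exists>ws\<in>lists alphabet. word_product ws (Some a) = Some c)" for a c
    by (force simp: im_ev_def Mon_at_def ev_def Mon_eq_words)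
  fix a b assume "b \<notin> im_ev a" "a \<notin> im_ev b"
  then show "im_ev a \<inter> im_ev b = {}"
    unfolding im_ev_iff disjoint_iff using words_meet by metis
qed

end
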